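(* Let $R$ be a ranked poset with edges colored by the index set $I$ of a choice of simple roots for a finite root system $\Phi$. Let $J\subseteq I$ and let $\nu=\sum_{j\in J}\nu_j\omega_j^J\in\Lambda_{\Phi_J}^+$. Suppose that $\mathrm{WGF}(R)|_J$ is $W_J$-invariant. Suppose that there is a subset $\mathcal S_{J,\nu}(R)$ of $R$ such that $\nu+wt^J(\mathbf s)\in\Lambda_{\Phi_J}^+$ for all $\mathbf s\in\mathcal S_{J,\nu}(R)$. Further suppose that there is a bijection $\tau:R\setminus\mathcal S_{J,\nu}(R)\to R\setminus\mathcal S_{J,\nu}(R)$ and a function $\kappa:R\setminus\mathcal S_{J,\nu}(R)\to J$ such that for all $\mathbf x\in R\setminus\mathcal S_{J,\nu}(R)$, $$wt^J(\tau(\mathbf x))=wt^J(\mathbf x)-\bigl(1+\nu_{\kappa(\mathbf x)}+m_{\kappa(\mathbf x)}(\mathbf x)\bigr)\alpha_{\kappa(\mathbf x)}.$$ Then $$\chi^{\Phi_J}_{\nu}\cdot \mathrm{WGF}(R)|_J=\sum_{\mathbf s\in\mathcal S_{J,\nu}(R)}\chi^{\Phi_J}_{\nu+wt^J(\mathbf s)}.$$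
   Context: Root systems. $\Phi$ is a finite (reduced, crystallographic) root system spanning a Euclidean space with inner product $\langle\cdot,\cdot\rangle$, with chosen simple roots $\{\alpha_i\}_{i\in I}$; $\alpha^\vee=2\alpha/\langle\alpha,\alpha\rangle$. The fundamental weights $\{\omega_i\}$ are dual to the simple coroots; $\Lambda=\bigoplus_i\mathbb Z\omega_i$; $\Lambda^+=\bigoplus_i\mathbb Z_{\ge0}\omega_i$ (dominant weights); $W$ is the Weyl group, generated by $s_i(v)=v-\langle v,\alpha_i^\vee\rangle\alpha_i$; $\varrho=\sum_i\omega_i$. $\mathbb Z[\Lambda]$ is the group ring with basis $\{e^\mu\}_{\mu\in\Lambda}$, $e^\mu e^\nu=e^{\mu+\nu}$, $w.e^\mu=e^{w(\mu)}$. Put $\mathcal A(e^\mu)=\sum_{w\in W}\det(w)e^{w(\mu)}$. For $\lambda\in\Lambda^+$ the Weyl bialternant $\chi_\lambda=\chi_\lambda^\Phi$ is the unique element of $\mathbb Z[\Lambda]$ with $\mathcal A(e^\varrho)\chi_\lambda=\mathcal A(e^{\lambda+\varrho})$; it is $W$-invariant. For $J\subseteq I$, $\Phi_J$ is the root subsystem with simple roots $\{\alpha_j\}_{j\in J}$, with Weyl group $W_J$, fundamental weights $\omega_j^J$ ($j\in J$), weight lattice $\Lambda_{\Phi_J}$, dominant weights $\Lambda_{\Phi_J}^+$, bialternants $\chi^{\Phi_J}_\nu$. For $\mu=\sum_{i\in I}m_i\omega_i$ put $\mu^J=\sum_{j\in J}m_j\omega_j^J$; for $\chi=\sum c_\mu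 e^\mu\in\mathbb Z[\Lambda]$ put $\chi|_J=\sum c_\mu e^{\mu^J}\in\mathbb Z[\Lambda_{\Phi_J}]$. Posets. All posets are finite and identified with their Hasse diagrams (directed edge $\mathbf s\to\mathbf t$ iff $\mathbf t$ covers $\mathbf s$). A poset is ranked if there is a surjection $\rho:R\to\{0,1,\dots,l\}$ with $\rho(\mathbf s)+1=\rho(\mathbf t)$ whenever $\mathbf s\to\mathbf t$; $l$ is its length. In a ranked poset $R$ with each Hasse edge assigned a color from $I$, $\mathrm{comp}_i(\mathbf x)$ is the connected component of $\mathbf x$ in the graph retaining only edges of color $i$; $\rho_i(\mathbf x)$ is the rank of $\mathbf x$ in $\mathrm{comp}_i(\mathbf x)$, $l_i(\mathbf x)$ the length of $\mathrm{comp}_i(\mathbf x)$, $\delta_i=l_i-\rho_i$, $m_i=2\rho_i-l_i=\rho_i-\delta_i$. For $J\subseteq I$, $wt^J(\mathbf x)=\sum_{j\in J}m_j(\mathbf x)\omega_j^J$; $wt=wt^I$; $\mathrm{WGF}(R)=\sum_{\mathbf x\in R}e^{wt(\mathbf x)}\in\mathbb Z[\Lambda]$. *)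

theory Defs
  imports "HOL-Analysis.Analysis" "HOL-Library.Poly_Mapping"
begin

section \<open>Root systems\<close>

text \<open>The Euclidean space spanned by a root system \<open>\<Phi>\<close> is the subspace \<open>span \<Phi>\<close> of
  \<open>real ^ 'n\<close>. It need not be everything, so that a root system and its root subsystems
  live in one type.\<close>

definition coroot :: "real ^ 'n \<Rightarrow> real ^ 'n" where
  "coroot a = (2 / (a \<bullet> a)) *\<^sub>R a"

definition reflection :: "real ^ 'n \<Rightarrow> real ^ 'n \<Rightarrow> real ^ 'n" where
  "reflection a v = v - (v \<bullet> coroot a) *\<^sub>R a"

definition root_system :: "(real ^ 'n) set \<Rightarrow> bool" where
  "root_system \<Phi> \<longleftrightarrow>
     finite \<Phi> \<and> 0 \<notin> \<Phi> \<and>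
     (\<forall>a\<in>\<Phi>. \<forall>b\<in>\<Phi>. reflection a b \<in> \<Phi>) \<and>
     (\<forall>a\<in>\<Phi>. \<forall>b\<in>\<Phi>. b \<bullet> coroot a \<in> \<int>) \<and>
     (\<forall>a\<in>\<Phi>. \<forall>c. c *\<^sub>R a \<in> \<Phi> \<longrightarrow> c = 1 \<or> c = - 1)"

definition simple_roots :: "(real ^ 'n) set \<Rightarrow> 'i set \<Rightarrow> ('i \<Rightarrow> real ^ 'n) \<Rightarrow> bool" where
  "simple_roots \<Phi> I \<alpha> \<longleftrightarrow>
     inj_on \<alpha> I \<and> \<alpha> ` I \<subseteq> \<Phi> \<and> independent (\<alpha> ` I) \<and>
     (\<forall>b\<in>\<Phi>. \<exists>c :: 'i \<Rightarrow> int. b = (\<Sum>i\<in>I. of_int (c i) *\<^sub>R \<alpha> i) \<and>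
        ((\<forall>i\<in>I. c i \<ge> 0) \<or> (\<forall>i\<in>I. c i \<le> 0)))"

definition root_subsystem :: "(real ^ 'n) set \<Rightarrow> ('i \<Rightarrow> real ^ 'n) \<Rightarrow> 'i set \<Rightarrow> (real ^ 'n) set" where
  "root_subsystem \<Phi> \<alpha> J = \<Phi> \<inter> span (\<alpha> ` J)"

lemma root_subsystem_root_system:
  assumes "root_system \<Phi>"
  shows "root_system (root_subsystem \<Phi> \<alpha> J)"
proof -
  have "reflection a b \<in> span (\<alpha> ` J)" if "a \<in> span (\<alpha> ` J)" "b \<in> span (\<alpha> ` J)" for a b
    unfolding reflection_def using that by (intro span_diff span_scale)
  then show ?thesis
    using assms unfolding root_system_def root_subsystem_def by simp blast
qed

lemma root_subsystem_simple_roots: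
  assumes \<Phi>: "root_system \<Phi>" and sr: "simple_roots \<Phi> I \<alpha>" and J: "J \<subseteq> I"
  shows "simple_roots (root_subsystem \<Phi> \<alpha> J) J \<alpha>"
proof -
  have inj: "inj_on \<alpha> I" and sub: "\<alpha> ` I \<subseteq> \<Phi>" and ind: "independent (\<alpha> ` I)"
    and comb: "\<And>b. b \<in> \<Phi> \<Longrightarrow> \<exists>c :: 'b \<Rightarrow> int. b = (\<Sum>i\<in>I. of_int (c i) *\<^sub>R \<alpha> i) \<and>
        ((\<forall>i\<in>I. c i \<ge> 0) \<or> (\<forall>i\<in>I. c i \<le> 0))"
    using sr unfolding simple_roots_def by auto
  have "finite \<Phi>" using \<Phi> by (simp add: root_system_def)
  then have finI: "finite I" using inj sub by (blast intro: inj_on_finite)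
  have "\<exists>c :: 'b \<Rightarrow> int. b = (\<Sum>i\<in>J. of_int (c i) *\<^sub>R \<alpha> i) \<and>
        ((\<forall>i\<in>J. c i \<ge> 0) \<or> (\<forall>i\<in>J. c i \<le> 0))" if b: "b \<in> \<Phi>" "b \<in> span (\<alpha> ` J)" for b
  proof -
    obtain c :: "'b \<Rightarrow> int" where c: "b = (\<Sum>i\<in>I. of_int (c i) *\<^sub>R \<alpha> i)"
      and sg: "(\<forall>i\<in>I. c i \<ge> 0) \<or> (\<forall>i\<in>I. c i \<le> 0)"
      using comb[OF b(1)] by auto
    have finJ: "finite J" using J finI finite_subset by auto
    have injJ: "inj_on \<alpha> J" using inj_on_subset[OF inj J] .
    obtain u where u: "b = (\<Sum>v\<in>\<alpha> ` J. u v *\<^sub>R v)"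
      using b(2) finJ span_finite[of "\<alpha> ` J"] by auto
    define d where "d = (\<lambda>i. of_int (c i) - (if i \<in> J then u (\<alpha> i) else 0))"
    have uJ: "b = (\<Sum>i\<in>J. u (\<alpha> i) *\<^sub>R \<alpha> i)"
      using u injJ by (simp add: sum.reindex)
    have uI: "b = (\<Sum>i\<in>I. (if i \<in> J then u (\<alpha> i) else 0) *\<^sub>R \<alpha> i)"
      unfolding uJ using J finI by (intro sum.mono_neutral_cong_left) auto
    have "(\<Sum>i\<in>I. d i *\<^sub>R \<alpha> i) = b - b"
      unfolding d_def scaleR_diff_left sum_subtractf c[symmetric] uI[symmetric] ..
    then have "(\<Sum>v\<in>\<alpha> ` I. d (the_inv_into I \<alpha> v) *\<^sub>R v) = 0"
      by (simp add: sum.reindex[OF inj] the_inv_into_f_f[OF inj])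
    then have d0: "d i = 0" if "i \<in> I" for i
      using independentD[OF ind _ subset_refl, of "\<lambda>v. d (the_inv_into I \<alpha> v)" "\<alpha> i"]
        finI that by (simp add: the_inv_into_f_f[OF inj])
    have "b = (\<Sum>i\<in>J. of_int (c i) *\<^sub>R \<alpha> i)"
      unfolding uJ using d0 J by (intro sum.cong) (auto simp: d_def)
    moreover have "(\<forall>i\<in>J. c i \<ge> 0) \<or> (\<forall>i\<in>J. c i \<le> 0)" using sg J by blast
    ultimately show ?thesis by (intro exI conjI)
  qed
  moreover have "\<alpha> ` J \<subseteq> root_subsystem \<Phi> \<alpha> J"
    using image_mono[OF J, of \<alpha>] sub span_superset[of "\<alpha> ` J"]
    unfolding root_subsystem_def by (meson Int_greatest subset_trans)
  moreover have "independent (\<alpha> ` J)"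
    using independent_mono[OF ind image_mono[OF J]] .
  moreover have "inj_on \<alpha> J" using inj_on_subset[OF inj J] .
  ultimately show ?thesis
    unfolding simple_roots_def by (intro conjI ballI) (simp_all add: root_subsystem_def)
qed

text \<open>All notions below depend on a root system only through its simple roots: the arguments
  \<open>\<alpha> J\<close> stand for the root system \<open>root_subsystem \<Phi> \<alpha> J\<close> with simple roots \<open>\<alpha> j\<close>, \<open>j \<in> J\<close>,
  in the Euclidean space \<open>span (\<alpha> ` J)\<close>. The case \<open>J = I\<close> is \<open>\<Phi>\<close> itself.\<close>

definition fund_weight :: "('i \<Rightarrow> real ^ 'n) \<Rightarrow> 'i set \<Rightarrow> 'i \<Rightarrow> real ^ 'n" where
  "fund_weight \<alpha> J j = (THE w. w \<in> span (\<alpha> ` J) \<and>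
     (\<forall>k\<in>J. w \<bullet> coroot (\<alpha> k) = (if k = j then 1 else 0)))"

definition weight_lattice :: "('i \<Rightarrow> real ^ 'n) \<Rightarrow> 'i set \<Rightarrow> (real ^ 'n) set" where
  "weight_lattice \<alpha> J = {\<Sum>j\<in>J. of_int (m j) *\<^sub>R fund_weight \<alpha> J j | m :: 'i \<Rightarrow> int. True}"

definition dominant_weights :: "('i \<Rightarrow> real ^ 'n) \<Rightarrow> 'i set \<Rightarrow> (real ^ 'n) set" where
  "dominant_weights \<alpha> J =
     {\<Sum>j\<in>J. of_int (m j) *\<^sub>R fund_weight \<alpha> J j | m :: 'i \<Rightarrow> int. \<forall>j\<in>J. m j \<ge> 0}"

definition weyl_vector :: "('i \<Rightarrow> real ^ 'n) \<Rightarrow> 'i set \<Rightarrow> real ^ 'n" where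
  "weyl_vector \<alpha> J = (\<Sum>j\<in>J. fund_weight \<alpha> J j)"

text \<open>The Weyl group acts on all of \<open>real ^ 'n\<close>, trivially on the orthogonal complement of
  \<open>span (\<alpha> ` J)\<close>; so the determinant on \<open>real ^ 'n\<close> is the one on the span. The generators are
  involutions, so the generated monoid is the generated group.\<close>

inductive_set weyl_group :: "('i \<Rightarrow> real ^ 'n) \<Rightarrow> 'i set \<Rightarrow> (real ^ 'n \<Rightarrow> real ^ 'n) set"
  for \<alpha> :: "'i \<Rightarrow> real ^ 'n" and J :: "'i set" where
  weyl_id: "id \<in> weyl_group \<alpha> J"
| weyl_step: "j \<in> J \<Longrightarrow> w \<in> weyl_group \<alpha> J \<Longrightarrow> reflection (\<alpha> j) \<circ> w \<in> weyl_group \<alpha> J"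

section \<open>The group ring and Weyl bialternants\<close>

text \<open>The group ring of a weight lattice is the subring of \<open>real ^ 'n \<Rightarrow>\<^sub>0 int\<close> (with the
  convolution product) of the elements whose keys are in the lattice.\<close>

abbreviation fexp :: "real ^ 'n \<Rightarrow> (real ^ 'n \<Rightarrow>\<^sub>0 int)" where
  "fexp \<mu> \<equiv> Poly_Mapping.single \<mu> 1"

text \<open>The additive extension of \<open>e\<^sup>\<mu> \<mapsto> e\<^bsup>g \<mu>\<^esup>\<close>.\<close>

definition push_weights :: "('a \<Rightarrow> 'b) \<Rightarrow> ('a \<Rightarrow>\<^sub>0 int) \<Rightarrow> ('b \<Rightarrow>\<^sub>0 int)" where
  "push_weights g f =
     (\<Sum>\<mu>\<in>Poly_Mapping.keys f. Poly_Mapping.single (g \<mu>) (Poly_Mapping.lookup f \<mu>))"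

definition weyl_invariant :: "('i \<Rightarrow> real ^ 'n) \<Rightarrow> 'i set \<Rightarrow> (real ^ 'n \<Rightarrow>\<^sub>0 int) \<Rightarrow> bool" where
  "weyl_invariant \<alpha> J f \<longleftrightarrow> (\<forall>w\<in>weyl_group \<alpha> J. push_weights w f = f)"

text \<open>The floor only converts \<open>det w = \<plusminus>1\<close> from a real number to an integer.\<close>

definition alternant :: "('i \<Rightarrow> real ^ 'n) \<Rightarrow> 'i set \<Rightarrow> real ^ 'n \<Rightarrow> (real ^ 'n \<Rightarrow>\<^sub>0 int)" where
  "alternant \<alpha> J \<mu> = (\<Sum>w\<in>weyl_group \<alpha> J. Poly_Mapping.single (w \<mu>) \<lfloor>det (matrix w)\<rfloor>)"

definition bialternant :: "('i \<Rightarrow> real ^ 'n) \<Rightarrow> 'i set \<Rightarrow> real ^ 'n \<Rightarrow> (real ^ 'n \<Rightarrow>\<^sub>0 int)" where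
  "bialternant \<alpha> J \<mu> = (THE f. Poly_Mapping.keys f \<subseteq> weight_lattice \<alpha> J \<and>
     alternant \<alpha> J (weyl_vector \<alpha> J) * f = alternant \<alpha> J (\<mu> + weyl_vector \<alpha> J))"

text \<open>For \<open>\<mu> = \<Sum>i\<in>I. m i *\<^sub>R fund_weight \<alpha> I i\<close> the coefficient \<open>m j\<close> is
  \<open>\<mu> \<bullet> coroot (\<alpha> j)\<close>; see \<open>restrict_weight_sum\<close> below.\<close>

definition restrict_weight :: "('i \<Rightarrow> real ^ 'n) \<Rightarrow> 'i set \<Rightarrow> real ^ 'n \<Rightarrow> real ^ 'n" where
  "restrict_weight \<alpha> J \<mu> = (\<Sum>j\<in>J. (\<mu> \<bullet> coroot (\<alpha> j)) *\<^sub>R fund_weight \<alpha> J j)"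

lemma fund_weight_dual:
  fixes \<alpha> :: "'i \<Rightarrow> real ^ 'n"
  assumes ind: "independent (\<alpha> ` J)" and inj: "inj_on \<alpha> J" and j: "j \<in> J"
  shows "fund_weight \<alpha> J j \<in> span (\<alpha> ` J)"
    and "k \<in> J \<Longrightarrow> fund_weight \<alpha> J j \<bullet> coroot (\<alpha> k) = (if k = j then 1 else 0)"
proof -
  let ?P = "\<lambda>w. w \<in> span (\<alpha> ` J) \<and> (\<forall>k\<in>J. w \<bullet> coroot (\<alpha> k) = (if k = j then 1 else 0))"
  have nz: "\<alpha> k \<noteq> 0" if "k \<in> J" for k
    using ind that dependent_zero by (metis image_eqI)
  obtain u z where uz: "\<alpha> j = u + z" "u \<in> span (\<alpha> ` (J - {j}))"
      "\<And>w. w \<in> span (\<alpha> ` (J - {j})) \<Longrightarrow> orthogonal z w"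
    using orthogonal_subspace_decomp_exists[of "\<alpha> ` (J - {j})" "\<alpha> j"] by metis
  have img: "\<alpha> ` (J - {j}) = \<alpha> ` J - {\<alpha> j}"
    using inj j by (auto simp: inj_on_eq_iff)
  have "\<alpha> j \<notin> span (\<alpha> ` (J - {j}))"
    unfolding img using ind j unfolding dependent_def by blast
  then have "z \<noteq> 0" using uz(1,2) by auto
  have zk: "z \<bullet> \<alpha> k = 0" if "k \<in> J" "k \<noteq> j" for k
    using uz(3)[of "\<alpha> k"] that by (simp add: orthogonal_def span_base)
  have zj: "z \<bullet> \<alpha> j = z \<bullet> z"
    using uz(3)[OF uz(2)] by (simp add: uz(1) inner_add_right orthogonal_def)
  have "u \<in> span (\<alpha> ` J)"
    using uz(2) span_mono[of "\<alpha> ` (J - {j})" "\<alpha> ` J"] by blast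
  moreover have "\<alpha> j \<in> span (\<alpha> ` J)" using j by (simp add: span_base)
  moreover have "z = \<alpha> j - u" using uz(1) by simp
  ultimately have zspan: "z \<in> span (\<alpha> ` J)" by (simp add: span_diff)
  define y where "y = ((\<alpha> j \<bullet> \<alpha> j) / (2 * (z \<bullet> z))) *\<^sub>R z"
  have "y \<in> span (\<alpha> ` J)" using zspan by (simp add: y_def span_scale)
  moreover have "y \<bullet> coroot (\<alpha> k) = (if k = j then 1 else 0)" if "k \<in> J" for k
    using zk[OF that] zj nz[OF j] \<open>z \<noteq> 0\<close> by (simp add: y_def coroot_def)
  ultimately have "?P y" by blast
  moreover have "w = y" if w: "?P w" for w
  proof -
    have "(w - y) \<bullet> \<alpha> k = 0" if "k \<in> J" for k
    proof -
      have "(w - y) \<bullet> coroot (\<alpha> k) = 0"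
        using w \<open>?P y\<close> that by (simp add: inner_diff_left)
      then show ?thesis using nz[OF that] by (simp add: coroot_def)
    qed
    then have "\<forall>x\<in>span (\<alpha> ` J). orthogonal (w - y) x"
      using orthogonal_to_span[of _ "\<alpha> ` J" "w - y"] by (auto simp: orthogonal_def)
    moreover have "w - y \<in> span (\<alpha> ` J)" using w \<open>?P y\<close> by (simp add: span_diff)
    ultimately have "orthogonal (w - y) (w - y)" by blast
    then show ?thesis by (simp add: orthogonal_def)
  qed
  ultimately have *: "?P (fund_weight \<alpha> J j)"
    unfolding fund_weight_def by (intro theI[of ?P y]) blast+
  show "fund_weight \<alpha> J j \<in> span (\<alpha> ` J)" using * by blast
  show "fund_weight \<alpha> J j \<bullet> coroot (\<alpha> k) = (if k = j then 1 else 0)" if "k \<in> J"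
    using * that by blast
qed

lemma restrict_weight_sum:
  fixes \<alpha> :: "'i \<Rightarrow> real ^ 'n"
  assumes "root_system \<Phi>" "simple_roots \<Phi> I \<alpha>" and J: "J \<subseteq> I"
  shows "restrict_weight \<alpha> J (\<Sum>i\<in>I. of_int (m i) *\<^sub>R fund_weight \<alpha> I i) =
    (\<Sum>j\<in>J. of_int (m j) *\<^sub>R fund_weight \<alpha> J j)"
proof -
  have inj: "inj_on \<alpha> I" and ind: "independent (\<alpha> ` I)" and fin: "finite I"
    using assms unfolding simple_roots_def root_system_def
    by (auto dest: inj_on_finite)
  have "(\<Sum>i\<in>I. of_int (m i) *\<^sub>R fund_weight \<alpha> I i) \<bullet> coroot (\<alpha> j) = of_int (m j)"
    if "j \<in> J" for j
  proof -
    have "j \<in> I" using that J by blast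
    then have "(\<Sum>i\<in>I. of_int (m i) *\<^sub>R fund_weight \<alpha> I i) \<bullet> coroot (\<alpha> j)
        = (\<Sum>i\<in>I. if j = i then of_int (m i) else 0)"
      unfolding inner_sum_left using fund_weight_dual(2)[OF ind inj]
      by (intro sum.cong) auto
    then show ?thesis using \<open>j \<in> I\<close> fin by simp
  qed
  then show ?thesis unfolding restrict_weight_def by simp
qed

section \<open>Ranked posets with colored edges\<close>

text \<open>A poset is given by its carrier \<open>R\<close> and its (reflexive) order relation \<open>r\<close>;
  \<open>hasse r\<close> is the set of edges of its Hasse diagram.\<close>

definition hasse :: "'v rel \<Rightarrow> 'v rel" where
  "hasse r = {(s, t). (s, t) \<in> r \<and> s \<noteq> t \<and>
     \<not> (\<exists>u. (s, u) \<in> r \<and> (u, t) \<in> r \<and> u \<noteq> s \<and> u \<noteq> t)}"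

definition rank_function :: "'v set \<Rightarrow> 'v rel \<Rightarrow> ('v \<Rightarrow> nat) \<Rightarrow> nat \<Rightarrow> bool" where
  "rank_function C E \<rho> l \<longleftrightarrow>
     \<rho> ` C = {0..l} \<and> (\<forall>s\<in>C. \<forall>t\<in>C. (s, t) \<in> E \<longrightarrow> \<rho> s + 1 = \<rho> t)"

definition ranked_poset :: "'v set \<Rightarrow> 'v rel \<Rightarrow> bool" where
  "ranked_poset R r \<longleftrightarrow>
     finite R \<and> partial_order_on R r \<and> (\<exists>\<rho> l. rank_function R (hasse r) \<rho> l)"

definition color_edges :: "'v rel \<Rightarrow> ('v \<times> 'v \<Rightarrow> 'i) \<Rightarrow> 'i \<Rightarrow> 'v rel" where
  "color_edges r col i = {e \<in> hasse r. col e = i}"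

definition comp :: "'v rel \<Rightarrow> ('v \<times> 'v \<Rightarrow> 'i) \<Rightarrow> 'i \<Rightarrow> 'v \<Rightarrow> 'v set" where
  "comp r col i x = {y. (x, y) \<in> (color_edges r col i \<union> (color_edges r col i)\<inverse>)\<^sup>*}"

text \<open>In a ranked poset, a component has exactly one rank function, since it is connected
  and ranks start at \<open>0\<close>.\<close>

definition comp_rank :: "'v rel \<Rightarrow> ('v \<times> 'v \<Rightarrow> 'i) \<Rightarrow> 'i \<Rightarrow> 'v \<Rightarrow> nat" where
  "comp_rank r col i x =
     (THE n. \<exists>\<rho> l. rank_function (comp r col i x) (color_edges r col i) \<rho> l \<and> n = \<rho> x)"

definition comp_length :: "'v rel \<Rightarrow> ('v \<times> 'v \<Rightarrow> 'i) \<Rightarrow> 'i \<Rightarrow> 'v \<Rightarrow> nat" where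
  "comp_length r col i x =
     (THE l. \<exists>\<rho>. rank_function (comp r col i x) (color_edges r col i) \<rho> l)"

definition mval :: "'v rel \<Rightarrow> ('v \<times> 'v \<Rightarrow> 'i) \<Rightarrow> 'i \<Rightarrow> 'v \<Rightarrow> int" where
  "mval r col i x = 2 * int (comp_rank r col i x) - int (comp_length r col i x)"

definition wt :: "('i \<Rightarrow> real ^ 'n) \<Rightarrow> 'i set \<Rightarrow> 'v rel \<Rightarrow> ('v \<times> 'v \<Rightarrow> 'i) \<Rightarrow> 'v \<Rightarrow> real ^ 'n" where
  "wt \<alpha> J r col x = (\<Sum>j\<in>J. of_int (mval r col j x) *\<^sub>R fund_weight \<alpha> J j)"

definition WGF :: "('i \<Rightarrow> real ^ 'n) \<Rightarrow> 'i set \<Rightarrow> 'v set \<Rightarrow> 'v rel \<Rightarrow> ('v \<times> 'v \<Rightarrow> 'i) \<Rightarrow>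
    (real ^ 'n \<Rightarrow>\<^sub>0 int)" where
  "WGF \<alpha> I R r col = (\<Sum>x\<in>R. fexp (wt \<alpha> I r col x))"

end

theory Submission imports Defs begin

text \<open>Write \<open>A \<mu>\<close> for the alternant of \<open>\<mu>\<close>. Since \<open>F = WGF(R)|\<^sub>J\<close> is invariant,
  \<open>A (\<nu> + \<rho>) * F\<close> is the sum of \<open>A (\<nu> + \<rho> + wt\<^sup>J x)\<close> over \<open>x \<in> R\<close>. The hypothesis on \<open>\<tau>\<close> says that
  the simple reflection \<open>s\<^bsub>\<kappa> x\<^esub>\<close> maps \<open>\<nu> + \<rho> + wt\<^sup>J x\<close> to \<open>\<nu> + \<rho> + wt\<^sup>J (\<tau> x)\<close>, so the part of the sum
  over \<open>R - S\<close> equals its own negative and vanishes. It remains to cancel \<open>A \<rho>\<close>. Existence of the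
  bialternants is obtained without unique factorization, by induction on the norm, from the products of
  \<open>A \<rho>\<close> with orbit sums.\<close>

section \<open>Reflections\<close>

lemma reflection_eq: "reflection a v = v - (2 * (v \<bullet> a) / (a \<bullet> a)) *\<^sub>R a"
  by (simp add: reflection_def coroot_def)

lemma linear_reflection: "linear (reflection a)"
  unfolding reflection_def by (rule linearI) (simp_all add: inner_add_left algebra_simps)

lemma reflection_inner: "reflection a u \<bullet> v = u \<bullet> reflection a v"
  by (simp add: reflection_eq inner_diff_left inner_diff_right inner_commute)

lemma reflection_involution [simp]: "reflection a (reflection a v) = v"
  by (cases "a = 0") (simp_all add: reflection_eq inner_diff_left scaleR_left_diff_distrib)

lemma reflection_self: "reflection a a = - a"
  by (cases "a = 0") (simp_all add: reflection_eq scaleR_2)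

lemma orthogonal_transformation_reflection: "orthogonal_transformation (reflection a)"
  by (simp add: orthogonal_transformation_def linear_reflection reflection_inner)

lemma reflection_orthogonal_transformation:
  assumes "orthogonal_transformation f"
  shows "f (reflection b v) = reflection (f b) (f v)"
  using assms
  by (simp add: orthogonal_transformation_def reflection_eq linear_diff linear_scale)

text \<open>All reflections in nonzero vectors are conjugate under orthogonal maps, up to the length
  of the vector. For a multiple of a basis vector the matrix is diagonal with a single entry
  -1.\<close>

lemma det_reflection:
  fixes a :: "real ^ 'n"
  assumes "a \<noteq> 0"
  shows "det (matrix (reflection a)) = - 1"
proof -
  fix i :: 'n
  \<comment> \<open>The length of \<open>b\<close> is chosen so that an orthogonal map taking
    \<open>b\<close> to \<open>a\<close> exists.\<close>
  define b where "b = norm a *\<^sub>R (axis i 1 :: real ^ 'n)"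
  have "norm b = norm a" by (simp add: b_def norm_axis_1)
  then obtain f where f: "orthogonal_transformation f" "f b = a"
    using orthogonal_transformation_exists by metis
  have lf: "linear f" using f by (simp add: orthogonal_transformation_def)
  have df: "det (matrix f) \<noteq> 0" using orthogonal_transformation_det[OF f(1)] by auto
  have "reflection a \<circ> f = f \<circ> reflection b"
    using reflection_orthogonal_transformation[OF f(1), of b] f(2) by auto
  then have "det (matrix (reflection a)) * det (matrix f)
      = det (matrix f) * det (matrix (reflection b))"
    by (metis det_mul matrix_compose lf linear_reflection)
  then have "det (matrix (reflection a)) = det (matrix (reflection b))" using df by simp
  also have "matrix (reflection b) $ j $ k = (if j = k then if j = i then - 1 else 1 else 0)" for j k
  proof -
    have "reflection b (axis k 1) = (if k = i then - axis k 1 else axis k 1)"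
      using assms by (simp add: reflection_eq b_def inner_axis_axis power2_eq_square scaleR_2)
    then show ?thesis by (simp add: matrix_def axis_def)
  qed
  then have "det (matrix (reflection b)) = (\<Prod>j\<in>UNIV. if j = i then - 1 else 1)"
    by (subst det_diagonal) simp_all
  also have "\<dots> = - 1" by (simp add: prod.delta)
  finally show ?thesis .
qed

section \<open>Group rings\<close>

text \<open>Zero coefficients contribute nothing, so two elements and their sum can be pushed
  forward over one common index set. This gives additivity although the keys of a sum may shrink by
  cancellation.\<close>

lemma push_weights_superset:
  assumes "finite A" "Poly_Mapping.keys f \<subseteq> A"
  shows "push_weights g f =
    (\<Sum>\<mu>\<in>A. Poly_Mapping.single (g \<mu>) (Poly_Mapping.lookup f \<mu>))"
  unfolding push_weights_def using assms
  by (intro sum.mono_neutral_left) (auto simp: in_keys_iff)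

lemma push_weights_add: "push_weights g (f + f') = push_weights g f + push_weights g f'"
proof -
  let ?A = "Poly_Mapping.keys f \<union> Poly_Mapping.keys f'"
  have "push_weights g h = (\<Sum>\<mu>\<in>?A. Poly_Mapping.single (g \<mu>) (Poly_Mapping.lookup h \<mu>))"
    if "Poly_Mapping.keys h \<subseteq> ?A" for h
    using that by (intro push_weights_superset) simp_all
  then show ?thesis
    by (simp add: Poly_Mapping.keys_add lookup_add single_add sum.distrib)
qed

lemma push_weights_sum_fexp:
  assumes "finite A"
  shows "push_weights g (\<Sum>x\<in>A. fexp (p x)) = (\<Sum>x\<in>A. fexp (g (p x)))"
  using assms
proof induction
  case empty
  show ?case by (simp add: push_weights_def)
next
  case (insert x A)
  have "push_weights g (fexp (p x)) = fexp (g (p x))" by (simp add: push_weights_def)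
  with insert show ?case by (simp add: push_weights_add)
qed

lemma lookup_single_mult:
  fixes a :: "'a :: ab_group_add"
  shows "Poly_Mapping.lookup (Poly_Mapping.single a c * f) k = c * Poly_Mapping.lookup f (k - a)"
proof -
  let ?K = "Poly_Mapping.keys f"
  have "f = (\<Sum>\<mu>\<in>?K. Poly_Mapping.single \<mu> (Poly_Mapping.lookup f \<mu>))"
    by (rule poly_mapping_eqI)
      (simp add: lookup_sum lookup_single when_def in_keys_iff)
  then have "Poly_Mapping.single a c * f
      = (\<Sum>\<mu>\<in>?K. Poly_Mapping.single (a + \<mu>) (c * Poly_Mapping.lookup f \<mu>))"
    by (metis (no_types, lifting) mult_single sum.cong sum_distrib_left)
  moreover have "a + \<mu> = k \<longleftrightarrow> \<mu> = k - a" for \<mu> by (auto simp: algebra_simps)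
  ultimately show ?thesis
    by (simp add: lookup_sum lookup_single when_def in_keys_iff)
qed

text \<open>Integers have no 2-torsion. This makes sign-reversing arguments conclusive, for singular
  weights and for the sum over \<open>R - S\<close>.\<close>

lemma poly_mapping_eq_neg:
  fixes f :: "'a \<Rightarrow>\<^sub>0 int"
  assumes "f = - f"
  shows "f = 0"
proof (rule poly_mapping_eqI)
  fix k
  have "Poly_Mapping.lookup f k = - Poly_Mapping.lookup f k"
    using arg_cong[OF assms, of "\<lambda>g. Poly_Mapping.lookup g k"] by simp
  then show "Poly_Mapping.lookup f k = Poly_Mapping.lookup 0 k" by simp
qed

section \<open>Weyl groups\<close>

text \<open>The index set is called \<open>J\<close> because the main proof instantiates the locale
  with \<open>root_subsystem \<Phi> \<alpha> J\<close>; all facts on \<Phi>_J come from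
  here.\<close>

locale based_root_system =
  fixes \<Phi> :: "(real ^ 'n) set" and J :: "'i set" and \<alpha> :: "'i \<Rightarrow> real ^ 'n"
  assumes root_system: "root_system \<Phi>" and simple_roots: "simple_roots \<Phi> J \<alpha>"
begin

abbreviation W where "W \<equiv> weyl_group \<alpha> J"
abbreviation \<rho> where "\<rho> \<equiv> weyl_vector \<alpha> J"
abbreviation \<Lambda> where "\<Lambda> \<equiv> weight_lattice \<alpha> J"
abbreviation s where "s j \<equiv> reflection (\<alpha> j)"

lemma inj_simple: "inj_on \<alpha> J" and independent_simple: "independent (\<alpha> ` J)" and simple_in_roots: "j \<in> J \<Longrightarrow> \<alpha> j \<in> \<Phi>"
  using simple_roots by (auto simp: simple_roots_def)

lemma finite_roots: "finite \<Phi>" and zero_notin_roots: "0 \<notin> \<Phi>"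
  and reflection_root: "a \<in> \<Phi> \<Longrightarrow> b \<in> \<Phi> \<Longrightarrow> reflection a b \<in> \<Phi>"
  and cartan_integral: "a \<in> \<Phi> \<Longrightarrow> b \<in> \<Phi> \<Longrightarrow> b \<bullet> coroot a \<in> \<int>"
  and roots_reduced: "a \<in> \<Phi> \<Longrightarrow> c *\<^sub>R a \<in> \<Phi> \<Longrightarrow> c = 1 \<or> c = - 1"
  using root_system by (auto simp: root_system_def)

lemma finite_index: "finite J"
  using inj_simple finite_roots simple_in_roots by (auto intro: inj_on_finite)

lemma simple_nonzero: "j \<in> J \<Longrightarrow> \<alpha> j \<noteq> 0"
  using zero_notin_roots simple_in_roots by metis

section \<open>Weights and their coordinates\<close>

lemma inner_coroot_sign:
  assumes "a \<noteq> 0"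
  shows "v \<bullet> coroot a \<ge> 0 \<longleftrightarrow> v \<bullet> a \<ge> 0" "v \<bullet> coroot a = 0 \<longleftrightarrow> v \<bullet> a = 0"
proof -
  obtain c where "coroot a = c *\<^sub>R a" "c > 0" using assms by (simp add: coroot_def)
  then show "v \<bullet> coroot a \<ge> 0 \<longleftrightarrow> v \<bullet> a \<ge> 0" "v \<bullet> coroot a = 0 \<longleftrightarrow> v \<bullet> a = 0"
    by (auto simp: zero_le_mult_iff)
qed

text \<open>Such a vector is orthogonal to all simple roots, hence to their span, hence to itself.
  Vectors of the span are thus determined by their products with simple coroots.\<close>

lemma span_eq_zero:
  assumes v: "v \<in> span (\<alpha> ` J)" and "\<And>j. j \<in> J \<Longrightarrow> v \<bullet> coroot (\<alpha> j) = 0"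
  shows "v = 0"
proof -
  have "v \<bullet> \<alpha> j = 0" if "j \<in> J" for j
    using inner_coroot_sign(2)[OF simple_nonzero[OF that]] assms(2)[OF that] by simp
  then have "orthogonal v x" if "x \<in> span (\<alpha> ` J)" for x
    using orthogonal_to_span[OF that, of v] by (auto simp: orthogonal_def)
  from this[OF v] show ?thesis by (simp add: orthogonal_def)
qed

lemma fund_weight_comb:
  shows "(\<Sum>i\<in>J. c i *\<^sub>R fund_weight \<alpha> J i) \<in> span (\<alpha> ` J)"
    and "j \<in> J \<Longrightarrow> (\<Sum>i\<in>J. c i *\<^sub>R fund_weight \<alpha> J i) \<bullet> coroot (\<alpha> j) = c j"
proof -
  show "(\<Sum>i\<in>J. c i *\<^sub>R fund_weight \<alpha> J i) \<in> span (\<alpha> ` J)"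
    by (intro span_sum span_scale fund_weight_dual(1)[OF independent_simple inj_simple])
  assume j: "j \<in> J"
  have "(\<Sum>i\<in>J. c i *\<^sub>R fund_weight \<alpha> J i) \<bullet> coroot (\<alpha> j) = (\<Sum>i\<in>J. if j = i then c i else 0)"
    unfolding inner_sum_left using fund_weight_dual(2)[OF independent_simple inj_simple _ j] by (intro sum.cong) auto
  then show "(\<Sum>i\<in>J. c i *\<^sub>R fund_weight \<alpha> J i) \<bullet> coroot (\<alpha> j) = c j"
    using j finite_index by simp
qed

lemma restrict_weight_span:
  assumes "v \<in> span (\<alpha> ` J)"
  shows "restrict_weight \<alpha> J v = v"
proof -
  have "restrict_weight \<alpha> J v - v = 0"
    using assms by (intro span_eq_zero)
      (simp_all add: restrict_weight_def fund_weight_comb span_diff inner_diff_left)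
  then show ?thesis by simp
qed

text \<open>The coefficients of a weight are its products with the simple coroots; the floor only
  turns integral reals into integers.\<close>

lemma weight_lattice_iff:
  "v \<in> \<Lambda> \<longleftrightarrow> v \<in> span (\<alpha> ` J) \<and> (\<forall>j\<in>J. v \<bullet> coroot (\<alpha> j) \<in> \<int>)"
proof
  assume "v \<in> \<Lambda>"
  then show "v \<in> span (\<alpha> ` J) \<and> (\<forall>j\<in>J. v \<bullet> coroot (\<alpha> j) \<in> \<int>)"
    by (auto simp: weight_lattice_def fund_weight_comb)
next
  assume v: "v \<in> span (\<alpha> ` J) \<and> (\<forall>j\<in>J. v \<bullet> coroot (\<alpha> j) \<in> \<int>)"
  then have "v = (\<Sum>j\<in>J. of_int \<lfloor>v \<bullet> coroot (\<alpha> j)\<rfloor> *\<^sub>R fund_weight \<alpha> J j)"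
    using restrict_weight_span[of v] by (simp add: restrict_weight_def)
  then show "v \<in> \<Lambda>"
    unfolding weight_lattice_def mem_Collect_eq by (intro exI conjI TrueI)
qed

lemma dominant_weights_iff:
  "v \<in> dominant_weights \<alpha> J \<longleftrightarrow> v \<in> \<Lambda> \<and> (\<forall>j\<in>J. v \<bullet> coroot (\<alpha> j) \<ge> 0)"
proof
  assume "v \<in> dominant_weights \<alpha> J"
  then obtain m where "v = (\<Sum>j\<in>J. of_int (m j) *\<^sub>R fund_weight \<alpha> J j)" "\<forall>j\<in>J. m j \<ge> 0"
    by (auto simp: dominant_weights_def)
  then show "v \<in> \<Lambda> \<and> (\<forall>j\<in>J. v \<bullet> coroot (\<alpha> j) \<ge> 0)"
    by (auto simp: weight_lattice_iff fund_weight_comb)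
next
  assume v: "v \<in> \<Lambda> \<and> (\<forall>j\<in>J. v \<bullet> coroot (\<alpha> j) \<ge> 0)"
  then have "v = (\<Sum>j\<in>J. of_int \<lfloor>v \<bullet> coroot (\<alpha> j)\<rfloor> *\<^sub>R fund_weight \<alpha> J j)"
    using restrict_weight_span[of v] by (simp add: restrict_weight_def weight_lattice_iff)
  moreover have "\<forall>j\<in>J. \<lfloor>v \<bullet> coroot (\<alpha> j)\<rfloor> \<ge> 0" using v by simp
  ultimately show "v \<in> dominant_weights \<alpha> J"
    unfolding dominant_weights_def mem_Collect_eq by (intro exI conjI)
qed

lemma weight_lattice_add: "u \<in> \<Lambda> \<Longrightarrow> v \<in> \<Lambda> \<Longrightarrow> u + v \<in> \<Lambda>"
  and weight_lattice_diff: "u \<in> \<Lambda> \<Longrightarrow> v \<in> \<Lambda> \<Longrightarrow> u - v \<in> \<Lambda>"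
  by (auto simp: weight_lattice_iff span_add span_diff inner_add_left inner_diff_left)

lemma weyl_vector_lattice: "\<rho> \<in> \<Lambda>"
  and weyl_vector_coroot: "j \<in> J \<Longrightarrow> \<rho> \<bullet> coroot (\<alpha> j) = 1"
  using fund_weight_comb[where c = "\<lambda>_. 1"] by (auto simp: weyl_vector_def weight_lattice_iff)

lemma weyl_vector_simple:
  assumes "j \<in> J"
  shows "\<rho> \<bullet> \<alpha> j > 0"
  using inner_coroot_sign[OF simple_nonzero[OF assms], of \<rho>] weyl_vector_coroot[OF assms]
  by (simp add: less_le)

lemma weight_lattice_reflection:
  assumes "j \<in> J" "v \<in> \<Lambda>"
  shows "s j v \<in> \<Lambda>"
  unfolding weight_lattice_iff reflection_def
  using assms cartan_integral simple_in_roots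
  by (auto simp: weight_lattice_iff inner_diff_left span_base
      intro!: span_diff span_scale Ints_diff Ints_mult)

text \<open>The coroot coordinates determine a weight, are integers, and are bounded by
  Cauchy-Schwarz.\<close>

lemma finite_weights_norm_le:
  fixes B :: real
  shows "finite {v \<in> \<Lambda>. norm v \<le> B}"
proof -
  define c where "c = (\<lambda>v :: real ^ 'n. restrict (\<lambda>j. v \<bullet> coroot (\<alpha> j)) J)"
  have "inj_on c \<Lambda>"
  proof
    fix u v assume uv: "u \<in> \<Lambda>" "v \<in> \<Lambda>" and eq: "c u = c v"
    have "u - v = 0"
    proof (rule span_eq_zero)
      show "u - v \<in> span (\<alpha> ` J)"
        using weight_lattice_diff[OF uv] by (simp add: weight_lattice_iff)
      show "(u - v) \<bullet> coroot (\<alpha> j) = 0" if "j \<in> J" for j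
        using fun_cong[OF eq, of j] that by (simp add: c_def inner_diff_left)
    qed
    then show "u = v" by simp
  qed
  then have "inj_on c {v \<in> \<Lambda>. norm v \<le> B}" by (rule inj_on_subset) auto
  moreover have "c ` {v \<in> \<Lambda>. norm v \<le> B}
      \<subseteq> PiE J (\<lambda>j. {x \<in> \<int>. \<bar>x\<bar> \<le> B * norm (coroot (\<alpha> j))})"
  proof (clarsimp simp: c_def weight_lattice_iff)
    fix v :: "real ^ 'n" and j assume "norm v \<le> B"
    then show "\<bar>v \<bullet> coroot (\<alpha> j)\<bar> \<le> B * norm (coroot (\<alpha> j))"
      by (meson Cauchy_Schwarz_ineq2 mult_right_mono norm_ge_zero order_trans)
  qed
  moreover have "finite (PiE J (\<lambda>j. {x \<in> \<int>. \<bar>x\<bar> \<le> B * norm (coroot (\<alpha> j))}))"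
    using finite_index by (intro finite_PiE finite_abs_int_segment)
  ultimately show ?thesis by (meson finite_subset inj_on_finite)
qed

section \<open>Positive roots\<close>

text \<open>Each simple root has positive product with \<rho>, so the common sign of the
  coefficients of \<open>b\<close> is the sign of \<open>\<rho> \<bullet> b\<close>. From here on
  this sign is the test for positive roots.\<close>

lemma root_sign:
  assumes "b \<in> \<Phi>"
  shows "\<rho> \<bullet> b \<noteq> 0"
    and "\<rho> \<bullet> b > 0 \<Longrightarrow> \<exists>c. b = (\<Sum>i\<in>J. c i *\<^sub>R \<alpha> i) \<and> (\<forall>i\<in>J. c i \<ge> 0)"
proof -
  obtain c :: "'i \<Rightarrow> int" where c: "b = (\<Sum>i\<in>J. of_int (c i) *\<^sub>R \<alpha> i)"
    and sg: "(\<forall>i\<in>J. c i \<ge> 0) \<or> (\<forall>i\<in>J. c i \<le> 0)"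
    using simple_roots assms unfolding simple_roots_def by blast
  have hb: "\<rho> \<bullet> b = (\<Sum>i\<in>J. of_int (c i) * (\<rho> \<bullet> \<alpha> i))"
    by (simp add: c inner_sum_right)
  have "\<exists>i\<in>J. c i \<noteq> 0"
  proof (rule ccontr)
    assume "\<not> (\<exists>i\<in>J. c i \<noteq> 0)"
    then have "b = 0" by (simp add: c)
    then show False using assms zero_notin_roots by simp
  qed
  then obtain i where i: "i \<in> J" "c i \<noteq> 0" by blast
  have pos: "\<rho> \<bullet> b > 0" if "\<forall>i\<in>J. c i \<ge> 0"
    unfolding hb using that i weyl_vector_simple finite_index
    by (intro sum_pos2[where i = i]) (auto simp: less_le)
  have neg: "\<rho> \<bullet> b < 0" if "\<forall>i\<in>J. c i \<le> 0"
  proof -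
    have "(\<Sum>i\<in>J. - (of_int (c i) * (\<rho> \<bullet> \<alpha> i))) > 0"
      using that i weyl_vector_simple finite_index
      by (intro sum_pos2[where i = i])
        (auto simp: less_le mult_le_0_iff mult_less_0_iff)
    then show ?thesis by (simp add: hb sum_negf)
  qed
  show "\<rho> \<bullet> b \<noteq> 0" using sg pos neg by fastforce
  show "\<exists>c. b = (\<Sum>i\<in>J. c i *\<^sub>R \<alpha> i) \<and> (\<forall>i\<in>J. c i \<ge> 0)" if "\<rho> \<bullet> b > 0"
    using sg neg that c by (intro exI[of _ "\<lambda>i. of_int (c i)"]) fastforce
qed

lemma coeff_unique:
  assumes "(\<Sum>i\<in>J. c i *\<^sub>R \<alpha> i) = (\<Sum>i\<in>J. d i *\<^sub>R \<alpha> i)" "i \<in> J"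
  shows "c i = d i"
proof -
  have "(\<Sum>i\<in>J. (c i - d i) *\<^sub>R \<alpha> i) = 0"
    using assms(1) by (simp add: scaleR_left_diff_distrib sum_subtractf)
  then have "(\<Sum>v\<in>\<alpha> ` J. (c (the_inv_into J \<alpha> v) - d (the_inv_into J \<alpha> v)) *\<^sub>R v) = 0"
    by (simp add: sum.reindex[OF inj_simple] the_inv_into_f_f[OF inj_simple])
  then show ?thesis
    using independentD[OF independent_simple _ subset_refl,
        of "\<lambda>v. c (the_inv_into J \<alpha> v) - d (the_inv_into J \<alpha> v)" "\<alpha> i"]
      finite_index assms(2) by (simp add: the_inv_into_f_f[OF inj_simple])
qed

text \<open>Since \<open>b\<close> and \<open>s a b\<close> differ by a multiple of
  \<open>\<alpha> a\<close>, a sign change would leave \<open>b\<close> no other nonzero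
  coefficient. As the root system is reduced, \<open>b\<close> would be
  \<open>\<alpha> a\<close>.\<close>

lemma simple_reflection_positive:
  assumes a: "a \<in> J" and b: "b \<in> \<Phi>" "\<rho> \<bullet> b > 0" "b \<noteq> \<alpha> a"
  shows "\<rho> \<bullet> s a b > 0"
proof (rule ccontr)
  assume np: "\<not> \<rho> \<bullet> s a b > 0"
  have sb: "s a b \<in> \<Phi>" using a b reflection_root simple_in_roots by blast
  \<comment> \<open>Reflecting a root in itself gives its negative.\<close>
  then have "- s a b \<in> \<Phi>"
    using reflection_root[OF sb sb] by (simp add: reflection_self)
  moreover have "\<rho> \<bullet> (- s a b) > 0" using np root_sign(1)[OF sb] by simp
  ultimately obtain d where d: "- s a b = (\<Sum>i\<in>J. d i *\<^sub>R \<alpha> i)" "\<forall>i\<in>J. d i \<ge> 0"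
    using root_sign(2) by blast
  obtain c where c: "b = (\<Sum>i\<in>J. c i *\<^sub>R \<alpha> i)" "\<forall>i\<in>J. c i \<ge> 0"
    using root_sign(2)[OF b(1,2)] by blast
  define k where "k = b \<bullet> coroot (\<alpha> a)"
  have "(\<Sum>i\<in>J. (c i + d i) *\<^sub>R \<alpha> i) = b - s a b"
    by (simp add: scaleR_left_distrib sum.distrib flip: c(1) d(1))
  also have "\<dots> = (\<Sum>i\<in>J. (if i = a then k else 0) *\<^sub>R \<alpha> i)"
    using a finite_index by (simp add: reflection_def k_def if_distrib[of "\<lambda>x. x *\<^sub>R _"] sum.delta cong: if_cong)
  finally have sum_eq: "(\<Sum>i\<in>J. (c i + d i) *\<^sub>R \<alpha> i) = (\<Sum>i\<in>J. (if i = a then k else 0) *\<^sub>R \<alpha> i)" .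
  have eq: "c i + d i = (if i = a then k else 0)" if "i \<in> J" for i
    using coeff_unique[OF sum_eq that] .
  \<comment> \<open>Away from \<open>a\<close> two nonnegative coefficients add up to zero, so both
    vanish.\<close>
  then have "c i = 0" if "i \<in> J" "i \<noteq> a" for i
    using c(2) d(2) that by (smt (verit))
  then have "b = (\<Sum>i\<in>J. if i = a then c a *\<^sub>R \<alpha> a else 0)"
    unfolding c(1) by (intro sum.cong) auto
  then have ba: "b = c a *\<^sub>R \<alpha> a" using a finite_index by simp
  then have "c a = 1 \<or> c a = - 1" using roots_reduced[of "\<alpha> a" "c a"] b(1) a simple_in_roots by simp
  then have "b = \<alpha> a" using ba c(2) a by auto
  then show False using b(3) by simp
qed

section \<open>Words in the simple reflections and the exchange property\<close>

fun word :: "'i list \<Rightarrow> real ^ 'n \<Rightarrow> real ^ 'n" where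
  "word [] = id"
| "word (a # l) = s a \<circ> word l"

lemma weyl_group_words: "W = word ` lists J"
proof (intro set_eqI iffI)
  fix w assume "w \<in> W"
  then show "w \<in> word ` lists J"
  proof induction
    case weyl_id
    show ?case by (rule image_eqI[of _ _ "[]"]) simp_all
  next
    case (weyl_step j w)
    then obtain l where "w = word l" "l \<in> lists J" by blast
    with weyl_step(1) show ?case by (intro image_eqI[of _ _ "j # l"]) simp_all
  qed
next
  have "word l \<in> W" if "l \<in> lists J" for l
    using that
  proof induction
    case Nil
    show ?case unfolding word.simps by (rule weyl_id)
  next
    case (Cons a l)
    then show ?case unfolding word.simps by (intro weyl_step)
  qed
  then show "w \<in> W" if "w \<in> word ` lists J" for w using that by blast
qed

lemma weyl_orthogonal:
  assumes "w \<in> W"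
  shows "orthogonal_transformation w"
  using assms
proof induction
  case weyl_id
  show ?case by (simp add: id_def)
next
  case (weyl_step j w)
  then show ?case by (intro orthogonal_transformation_compose orthogonal_transformation_reflection)
qed

lemma weyl_linear: "w \<in> W \<Longrightarrow> linear w"
  and weyl_inner: "w \<in> W \<Longrightarrow> w u \<bullet> w v = u \<bullet> v"
  using weyl_orthogonal by (auto simp: orthogonal_transformation_def)

lemma weyl_norm: "w \<in> W \<Longrightarrow> norm (w v) = norm v"
  using weyl_inner by (simp add: norm_eq_sqrt_inner)

lemma weyl_compose:
  assumes "w \<in> W" "u \<in> W"
  shows "w \<circ> u \<in> W"
  using assms(1)
proof induction
  case weyl_id
  show ?case using assms(2) by simp
next
  case (weyl_step j w)
  then show ?case unfolding comp_assoc by (intro weyl_group.weyl_step)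
qed

lemma weyl_simple: "j \<in> J \<Longrightarrow> s j \<in> W"
  using weyl_step[OF _ weyl_id, of j J \<alpha>] by simp

lemma weyl_inverse:
  assumes "w \<in> W"
  shows "\<exists>u\<in>W. u \<circ> w = id \<and> w \<circ> u = id"
  using assms
proof induction
  case weyl_id
  then show ?case by (intro bexI[of _ id]) (auto intro: weyl_group.intros)
next
  case (weyl_step j w)
  then obtain u where u: "u \<in> W" "u \<circ> w = id" "w \<circ> u = id" by blast
  have "u (w x) = x" "w (u x) = x" for x using u by (auto dest: fun_cong)
  then show ?case
    using weyl_compose[OF u(1) weyl_simple[OF weyl_step(1)]]
    by (intro bexI[of _ "u \<circ> s j"]) auto
qed

lemma weyl_lattice: "w \<in> W \<Longrightarrow> v \<in> \<Lambda> \<Longrightarrow> w v \<in> \<Lambda>"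
  by (induction rule: weyl_group.induct) (auto intro: weight_lattice_reflection)

lemma weyl_root: "w \<in> W \<Longrightarrow> b \<in> \<Phi> \<Longrightarrow> w b \<in> \<Phi>"
  by (induction rule: weyl_group.induct) (auto intro: reflection_root simple_in_roots)

lemma weyl_bij: "w \<in> W \<Longrightarrow> bij w"
  using weyl_inverse by (metis o_bij)

text \<open>If \<open>b\<close> is the simple root of the leading letter, that letter cancels.
  Otherwise \<open>s a b\<close> is again positive, and conjugation moves the reflection past the
  letter into the shorter word. The empty word is excluded because it fixes \<rho>.\<close>

lemma exchange:
  assumes "l \<in> lists J" "b \<in> \<Phi>" "\<rho> \<bullet> b > 0" "word l \<rho> \<bullet> b < 0"
  shows "\<exists>l'\<in>lists J. length l' < length l \<and> word l' = reflection b \<circ> word l"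
  using assms
proof (induction l arbitrary: b)
  case Nil
  then show ?case by simp
next
  case (Cons a l)
  then have a: "a \<in> J" and l: "l \<in> lists J" by auto
  show ?case
  proof (cases "b = \<alpha> a")
    case True
    then show ?thesis using l by (intro bexI[of _ l]) auto
  next
    case False
    let ?b = "s a b"
    have "?b \<in> \<Phi>" using reflection_root simple_in_roots a Cons.prems by blast
    moreover have "\<rho> \<bullet> ?b > 0" using simple_reflection_positive a Cons.prems False by blast
    moreover have "word l \<rho> \<bullet> ?b < 0" using Cons.prems by (simp add: reflection_inner)
    ultimately obtain l' where l': "l' \<in> lists J" "length l' < length l"
      "word l' = reflection ?b \<circ> word l"
      using Cons.IH by blast
    have "word (a # l') = reflection b \<circ> word (a # l)"
      using reflection_orthogonal_transformation[OF orthogonal_transformation_reflection, of "\<alpha> a" ?b]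
      by (auto simp: l'(3))
    then show ?thesis using l' a by (intro bexI[of _ "a # l'"]) auto
  qed
qed

text \<open>Induction on word length. If the leading letter meets a negative product,
  \<open>exchange\<close> gives a shorter word for the whole element; hence the step only has to
  treat positive products, where heights go down.\<close>

lemma weyl_induct [consumes 1, case_names id step]:
  assumes "w \<in> W" and "P id"
    and step: "\<And>a w. a \<in> J \<Longrightarrow> w \<in> W \<Longrightarrow> w \<rho> \<bullet> \<alpha> a > 0 \<Longrightarrow> P w \<Longrightarrow> P (s a \<circ> w)"
  shows "P w"
proof -
  have "P (word l)" if "l \<in> lists J" for l
    using that
  proof (induction "length l" arbitrary: l rule: less_induct)
    case less
    show ?case
    proof (cases l)
      case Nil
      then show ?thesis using assms(2) by simp
    next
      case (Cons a k)
      then have a: "a \<in> J" and k: "k \<in> lists J" using less.prems by auto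
      have kW: "word k \<in> W" using k weyl_group_words by blast
      \<comment> \<open>Pulling back by the inverse of \<open>word k\<close> turns the product into
        \<open>\<rho> \<bullet> u (\<alpha> a)\<close>, and \<rho> is orthogonal to no root.\<close>
      obtain u where u: "u \<in> W" "u \<circ> word k = id" using weyl_inverse[OF kW] by blast
      have "word k \<rho> \<bullet> \<alpha> a = u (word k \<rho>) \<bullet> u (\<alpha> a)" by (simp add: weyl_inner[OF u(1)])
      also have "u (word k \<rho>) = \<rho>" using fun_cong[OF u(2), of \<rho>] by simp
      finally have nz: "word k \<rho> \<bullet> \<alpha> a \<noteq> 0"
        using root_sign(1)[OF weyl_root[OF u(1)]] simple_in_roots[OF a] by simp
      show ?thesis
      proof (cases "word k \<rho> \<bullet> \<alpha> a < 0")
        case True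
        then obtain l' where "l' \<in> lists J" "length l' < length k" "word l' = s a \<circ> word k"
          using exchange[OF k simple_in_roots[OF a] weyl_vector_simple[OF a]] by blast
        then show ?thesis using less.hyps[of l'] Cons by simp
      next
        case False
        then show ?thesis using step[OF a kW] nz less.hyps[of k] k Cons by simp
      qed
    qed
  qed
  then show ?thesis using assms(1) weyl_group_words by auto
qed

text \<open>The inverse of \<open>w\<close> sends \<open>\<alpha> a\<close> to a root that is
  positive by the assumption on \<rho>, so a dominant weight pairs nonnegatively with it.\<close>

lemma weyl_pairing_sign:
  assumes "w \<in> W" "a \<in> J" "w \<rho> \<bullet> \<alpha> a > 0" and dom: "\<And>j. j \<in> J \<Longrightarrow> \<mu> \<bullet> \<alpha> j \<ge> 0"
  shows "w \<mu> \<bullet> \<alpha> a \<ge> 0"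
proof -
  obtain u where u: "u \<in> W" "u \<circ> w = id" using weyl_inverse[OF assms(1)] by blast
  have pull: "w v \<bullet> \<alpha> a = v \<bullet> u (\<alpha> a)" for v
    using weyl_inner[OF u(1), of "w v" "\<alpha> a"] fun_cong[OF u(2), of v] by simp
  have "u (\<alpha> a) \<in> \<Phi>" using weyl_root u assms simple_in_roots by blast
  then obtain c where "u (\<alpha> a) = (\<Sum>i\<in>J. c i *\<^sub>R \<alpha> i)" "\<forall>i\<in>J. c i \<ge> 0"
    using root_sign(2)[of "u (\<alpha> a)"] assms(3) by (auto simp: pull)
  then show ?thesis
    unfolding pull by (auto simp: inner_sum_right intro!: sum_nonneg mult_nonneg_nonneg dom)
qed

text \<open>Each step of \<open>weyl_induct\<close> subtracts a nonnegative multiple of a simple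
  root. If the multiple is zero the weight stays, otherwise its height drops.\<close>

lemma dominant_height_maximal:
  assumes "w \<in> W" and dom: "\<And>j. j \<in> J \<Longrightarrow> \<mu> \<bullet> \<alpha> j \<ge> 0"
  shows "\<rho> \<bullet> w \<mu> < \<rho> \<bullet> \<mu> \<or> w \<mu> = \<mu>"
  using assms(1)
proof (induction rule: weyl_induct)
  case id
  then show ?case by simp
next
  case (step a w)
  define k where "k = w \<mu> \<bullet> coroot (\<alpha> a)"
  have k: "k \<ge> 0"
    using weyl_pairing_sign[OF step(2,1,3) dom]
    by (simp add: k_def inner_coroot_sign[OF simple_nonzero[OF step(1)]])
  have eq: "(s a \<circ> w) \<mu> = w \<mu> - k *\<^sub>R \<alpha> a" by (simp add: reflection_def k_def)
  then have h: "\<rho> \<bullet> (s a \<circ> w) \<mu> = \<rho> \<bullet> w \<mu> - k * (\<rho> \<bullet> \<alpha> a)" by (simp add: inner_diff_right)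
  show ?case
  proof (cases "k = 0")
    case True
    then show ?thesis using eq step.IH by simp
  next
    case False
    then have "k * (\<rho> \<bullet> \<alpha> a) > 0" using k weyl_vector_simple[OF step(1)] by simp
    then show ?thesis using h step.IH by auto
  qed
qed

text \<open>For \<rho> the subtracted multiple is strictly positive, so any last step lowers the
  height. In particular only the identity fixes \<rho>.\<close>

lemma weyl_vector_height_less:
  assumes "w \<in> W" "w \<noteq> id"
  shows "\<rho> \<bullet> w \<rho> < \<rho> \<bullet> \<rho>"
proof -
  have dom: "\<And>j. j \<in> J \<Longrightarrow> \<rho> \<bullet> \<alpha> j \<ge> 0" using weyl_vector_simple by (simp add: less_imp_le)
  have "w = id \<or> \<rho> \<bullet> w \<rho> < \<rho> \<bullet> \<rho>"
    using assms(1)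
  proof (induction rule: weyl_induct)
    case id
    then show ?case by simp
  next
    case (step a w)
    define k where "k = w \<rho> \<bullet> coroot (\<alpha> a)"
    have "k > 0"
      using step(3) inner_coroot_sign[OF simple_nonzero[OF step(1)], of "w \<rho>"]
      by (simp add: k_def less_le)
    then have "k * (\<rho> \<bullet> \<alpha> a) > 0" using weyl_vector_simple[OF step(1)] by simp
    moreover have "\<rho> \<bullet> (s a \<circ> w) \<rho> = \<rho> \<bullet> w \<rho> - k * (\<rho> \<bullet> \<alpha> a)"
      by (simp add: reflection_def k_def inner_diff_right)
    moreover have "\<rho> \<bullet> w \<rho> \<le> \<rho> \<bullet> \<rho>" using dominant_height_maximal[OF step(2) dom] by auto
    ultimately show ?case by simp
  qed
  then show ?thesis using assms(2) by blast
qed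

section \<open>Finiteness of the Weyl group\<close>

lemma weyl_orbit_finite: "v \<in> \<Lambda> \<Longrightarrow> finite ((\<lambda>w. w v) ` W)"
  by (rule finite_subset[OF _ finite_weights_norm_le[of "norm v"]])
    (auto simp: weyl_norm weyl_lattice)

lemma weyl_group_finite: "finite W"
proof -
  \<comment> \<open>As \<rho> has trivial stabilizer, the group embeds into the orbit of \<rho>, a
    set of lattice vectors of one norm.\<close>
  have "inj_on (\<lambda>w. w \<rho>) W"
  proof
    fix w w' assume w: "w \<in> W" and w': "w' \<in> W" and eq: "w \<rho> = w' \<rho>"
    obtain u where u: "u \<in> W" "u \<circ> w' = id" "w' \<circ> u = id" using weyl_inverse[OF w'] by blast
    have "(u \<circ> w) \<rho> = \<rho>" using eq fun_cong[OF u(2), of \<rho>] by simp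
    then have "u \<circ> w = id"
      using weyl_vector_height_less[OF weyl_compose[OF u(1) w]] by fastforce
    then have "w' \<circ> (u \<circ> w) = w'" by simp
    then show "w = w'" using u(3) by (simp add: o_assoc)
  qed
  then show ?thesis
    using finite_imageD weyl_orbit_finite[OF weyl_vector_lattice] by blast
qed


section \<open>Alternants and bialternants\<close>

lemma sign_cases:
  assumes "w \<in> W"
  shows "det (matrix w) = 1 \<or> det (matrix w) = - 1"
  using orthogonal_transformation_det[OF weyl_orthogonal[OF assms]] by (simp add: abs_eq_iff')

lemma sign_compose_reflection:
  assumes "w \<in> W" "j \<in> J"
  shows "\<lfloor>det (matrix (w \<circ> s j))\<rfloor> = - \<lfloor>det (matrix w)\<rfloor>"
proof -
  have "det (matrix (w \<circ> s j)) = - det (matrix w)"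
    by (simp add: matrix_compose[OF linear_reflection weyl_linear[OF assms(1)]] det_mul
        det_reflection[OF simple_nonzero[OF assms(2)]])
  moreover have "\<lfloor>- 1 :: real\<rfloor> = - 1" by linarith
  ultimately show ?thesis using sign_cases[OF assms(1)] by auto
qed

text \<open>Right multiplication by \<open>s j\<close> permutes the group and flips every
  determinant.\<close>

lemma alternant_reflection:
  assumes j: "j \<in> J"
  shows "alternant \<alpha> J (s j \<mu>) = - alternant \<alpha> J \<mu>"
proof -
  have involution: "w \<circ> s j \<circ> s j = w" for w :: "real ^ 'n \<Rightarrow> real ^ 'n" by auto
  have "alternant \<alpha> J (s j \<mu>) =
      (\<Sum>w\<in>W. Poly_Mapping.single ((w \<circ> s j \<circ> s j) \<mu>) \<lfloor>det (matrix (w \<circ> s j))\<rfloor>)"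
    unfolding alternant_def
    by (rule sum.reindex_bij_witness[where i = "\<lambda>w. w \<circ> s j" and j = "\<lambda>w. w \<circ> s j"])
      (simp_all add: involution weyl_compose weyl_simple j)
  also have "\<dots> = (\<Sum>w\<in>W. - Poly_Mapping.single (w \<mu>) \<lfloor>det (matrix w)\<rfloor>)"
    unfolding involution
    by (intro sum.cong refl) (simp add: sign_compose_reflection j single_uminus)
  finally show ?thesis by (simp add: alternant_def sum_negf)
qed

lemma alternant_weyl:
  assumes "w \<in> W"
  shows "alternant \<alpha> J (w \<mu>) = alternant \<alpha> J \<mu> \<or> alternant \<alpha> J (w \<mu>) = - alternant \<alpha> J \<mu>"
  using assms by induction (auto simp: alternant_reflection)

lemma alternant_singular:
  assumes "j \<in> J" "\<mu> \<bullet> coroot (\<alpha> j) = 0"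
  shows "alternant \<alpha> J \<mu> = 0"
proof -
  have "s j \<mu> = \<mu>" using assms(2) by (simp add: reflection_def)
  then show ?thesis using alternant_reflection[OF assms(1), of \<mu>] poly_mapping_eq_neg by metis
qed

text \<open>In the term of \<open>w\<close>, invariance allows each \<open>p x\<close> to be
  replaced by \<open>w (p x)\<close>; then \<open>w \<mu> + w (p x)\<close> combines by
  linearity.\<close>

lemma alternant_mult_invariant:
  assumes "finite A" and inv: "weyl_invariant \<alpha> J (\<Sum>x\<in>A. fexp (p x))"
  shows "alternant \<alpha> J \<mu> * (\<Sum>x\<in>A. fexp (p x)) = (\<Sum>x\<in>A. alternant \<alpha> J (\<mu> + p x))"
proof -
  let ?d = "\<lambda>w. \<lfloor>det (matrix w)\<rfloor>"
  have term_eq: "Poly_Mapping.single (w \<mu>) (?d w) * (\<Sum>x\<in>A. fexp (p x))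
      = (\<Sum>x\<in>A. Poly_Mapping.single (w (\<mu> + p x)) (?d w))" if w: "w \<in> W" for w
  proof -
    have "(\<Sum>x\<in>A. fexp (p x)) = (\<Sum>x\<in>A. fexp (w (p x)))"
      using inv w push_weights_sum_fexp[OF assms(1), of w p] by (simp add: weyl_invariant_def)
    then show ?thesis
      by (simp add: sum_distrib_left mult_single linear_add[OF weyl_linear[OF w]])
  qed
  have "alternant \<alpha> J \<mu> * (\<Sum>x\<in>A. fexp (p x))
      = (\<Sum>w\<in>W. \<Sum>x\<in>A. Poly_Mapping.single (w (\<mu> + p x)) (?d w))"
    unfolding alternant_def sum_distrib_right using term_eq by (intro sum.cong) auto
  also have "\<dots> = (\<Sum>x\<in>A. alternant \<alpha> J (\<mu> + p x))"
    unfolding alternant_def by (rule sum.swap)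
  finally show ?thesis .
qed

text \<open>Multiplying by the alternant of \<open>\<rho>\<close> keeps the terms of maximal height
  \<open>\<rho> \<bullet> \<mu>\<close>: among the weights \<open>w \<rho>\<close>, only \<open>\<rho>\<close> itself has the largest height.\<close>

lemma alternant_weyl_vector_cancel:
  assumes "alternant \<alpha> J \<rho> * f = 0"
  shows "f = 0"
proof (rule ccontr)
  assume "f \<noteq> 0"
  then have ne: "Poly_Mapping.keys f \<noteq> {}" by simp
  obtain \<mu> where \<mu>: "\<mu> \<in> Poly_Mapping.keys f"
    and max: "\<And>v. v \<in> Poly_Mapping.keys f \<Longrightarrow> \<rho> \<bullet> v \<le> \<rho> \<bullet> \<mu>"
    using obtains_MAX[OF finite_keys ne, of "\<lambda>v. \<rho> \<bullet> v"]
    by (metis (mono_tags, lifting) Max_ge finite_imageI finite_keys image_eqI)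
  have "Poly_Mapping.lookup (alternant \<alpha> J \<rho> * f) (\<rho> + \<mu>)
      = (\<Sum>w\<in>W. \<lfloor>det (matrix w)\<rfloor> * Poly_Mapping.lookup f (\<rho> + \<mu> - w \<rho>))"
    by (simp add: alternant_def sum_distrib_right lookup_sum lookup_single_mult)
  also have "\<dots> = (\<Sum>w\<in>W. if w = id then Poly_Mapping.lookup f \<mu> else 0)"
  proof (intro sum.cong refl)
    fix w assume w: "w \<in> W"
    show "\<lfloor>det (matrix w)\<rfloor> * Poly_Mapping.lookup f (\<rho> + \<mu> - w \<rho>)
        = (if w = id then Poly_Mapping.lookup f \<mu> else 0)"
    proof (cases "w = id")
      case True
      then show ?thesis by (simp add: matrix_id_mat_1)
    next
      case False
      have "\<rho> \<bullet> (\<rho> + \<mu> - w \<rho>) > \<rho> \<bullet> \<mu>"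
        using weyl_vector_height_less[OF w False] by (simp add: inner_add_right inner_diff_right)
      then have "\<rho> + \<mu> - w \<rho> \<notin> Poly_Mapping.keys f" using max by fastforce
      then show ?thesis using False by (simp add: in_keys_iff)
    qed
  qed
  also have "\<dots> = Poly_Mapping.lookup f \<mu>"
    using weyl_group_finite weyl_id[of \<alpha> J] by simp
  finally show False using assms \<mu> by (simp add: in_keys_iff)
qed

text \<open>Take a conjugate of maximal height: a negative product with a simple coroot would let
  the corresponding reflection raise the height.\<close>

lemma dominant_in_orbit:
  assumes "v \<in> \<Lambda>"
  shows "\<exists>w\<in>W. \<forall>j\<in>J. w v \<bullet> coroot (\<alpha> j) \<ge> 0"
proof -
  let ?H = "(\<lambda>w. \<rho> \<bullet> w v) ` W"
  have fin: "finite ?H" and ne: "?H \<noteq> {}" using weyl_group_finite weyl_id by blast+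
  obtain w where w: "w \<in> W" "\<rho> \<bullet> w v = Max ?H"
    using Max_in[OF fin ne] by auto
  have "w v \<bullet> coroot (\<alpha> j) \<ge> 0" if j: "j \<in> J" for j
  proof -
    have "\<rho> \<bullet> (s j \<circ> w) v \<le> \<rho> \<bullet> w v"
      unfolding w(2) using Max_ge[OF fin] weyl_step[OF j w(1)] by blast
    then have "(w v \<bullet> coroot (\<alpha> j)) * (\<rho> \<bullet> \<alpha> j) \<ge> 0"
      by (simp add: reflection_def inner_diff_right)
    then show ?thesis using weyl_vector_simple[OF j] by (simp add: zero_le_mult_iff)
  qed
  then show ?thesis using w(1) by blast
qed

text \<open>The product of the alternant of \<open>\<rho>\<close> with the orbit sum of \<open>\<mu>\<close> is the sum of the alternants of
  \<open>\<rho> + \<mu>'\<close> over the orbit. All these weights other than \<open>\<rho> + \<mu>\<close> are strictly shorter, and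
  their alternants vanish or are conjugate to dominant ones, so induction on the norm applies.\<close>

lemma bialternant_exists:
  assumes "\<mu> \<in> dominant_weights \<alpha> J"
  shows "\<exists>f. Poly_Mapping.keys f \<subseteq> \<Lambda> \<and> alternant \<alpha> J \<rho> * f = alternant \<alpha> J (\<mu> + \<rho>)"
  using assms
proof (induction "card {v \<in> \<Lambda>. norm v < norm (\<mu> + \<rho>)}" arbitrary: \<mu> rule: less_induct)
  case less
  let ?good = "\<lambda>g f. Poly_Mapping.keys f \<subseteq> \<Lambda> \<and> alternant \<alpha> J \<rho> * f = g"
  have good_uminus: "\<exists>f. ?good (- g) f" if "\<exists>f. ?good g f" for g
    using that by (metis keys_minus mult_minus_right)
  have dom: "\<mu> \<bullet> \<alpha> j \<ge> 0" if "j \<in> J" for j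
    using less.prems that inner_coroot_sign[OF simple_nonzero[OF that]]
    by (auto simp: dominant_weights_iff)
  have \<mu>: "\<mu> \<in> \<Lambda>" using less.prems by (simp add: dominant_weights_iff)
  define orb where "orb = (\<lambda>w. w \<mu>) ` W"
  have fin_orb: "finite orb" using weyl_orbit_finite[OF \<mu>] by (simp add: orb_def)
  have orb_lattice: "orb \<subseteq> \<Lambda>" using weyl_lattice \<mu> by (auto simp: orb_def)
  have \<mu>_orb: "\<mu> \<in> orb" unfolding orb_def by (rule image_eqI[OF _ weyl_id]) simp
  have "weyl_invariant \<alpha> J (\<Sum>v\<in>orb. fexp v)"
    unfolding weyl_invariant_def
  proof
    fix w assume w: "w \<in> W"
    have inj_w: "inj_on w orb" using weyl_bij[OF w] by (meson bij_is_inj inj_on_subset subset_UNIV)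
    have "w (u \<mu>) \<in> orb" if "u \<in> W" for u
      unfolding orb_def by (rule image_eqI[OF _ weyl_compose[OF w that]]) simp
    then have "w ` orb \<subseteq> orb" unfolding orb_def by blast
    then have "w ` orb = orb" using endo_inj_surj[OF fin_orb _ inj_w] by blast
    then have "(\<Sum>v\<in>orb. fexp (w v)) = (\<Sum>v\<in>orb. fexp v)"
      using sum.reindex[OF inj_w, of fexp] by simp
    then show "push_weights w (\<Sum>v\<in>orb. fexp v) = (\<Sum>v\<in>orb. fexp v)"
      using push_weights_sum_fexp[OF fin_orb, of w "\<lambda>v. v"] by simp
  qed
  then have orbit_sum: "alternant \<alpha> J \<rho> * (\<Sum>v\<in>orb. fexp v) = (\<Sum>v\<in>orb. alternant \<alpha> J (\<rho> + v))"
    using alternant_mult_invariant[OF fin_orb, of "\<lambda>v. v"] by simp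
  have "\<exists>f. ?good (alternant \<alpha> J (\<rho> + v)) f" if v: "v \<in> orb - {\<mu>}" for v
  proof -
    obtain u where u: "u \<in> W" "v = u \<mu>" using v by (auto simp: orb_def)
    have "\<rho> \<bullet> v < \<rho> \<bullet> \<mu>" using dominant_height_maximal[OF u(1) dom] u(2) v by auto
    moreover have "v \<bullet> v = \<mu> \<bullet> \<mu>" using weyl_inner[OF u(1)] u(2) by simp
    \<comment> \<open>The squared norms of \<open>v\<close> and \<open>\<mu>\<close> agree, so only
      the cross term with \<rho> decides.\<close>
    ultimately have "(\<rho> + v) \<bullet> (\<rho> + v) < (\<mu> + \<rho>) \<bullet> (\<mu> + \<rho>)"
      by (simp add: inner_add_left inner_add_right inner_commute)
    then have shorter: "norm (\<rho> + v) < norm (\<mu> + \<rho>)" by (simp add: norm_eq_sqrt_inner)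
    have \<rho>v: "\<rho> + v \<in> \<Lambda>" using v orb_lattice weyl_vector_lattice weight_lattice_add by blast
    obtain w where w: "w \<in> W" and wdom: "\<And>j. j \<in> J \<Longrightarrow> w (\<rho> + v) \<bullet> coroot (\<alpha> j) \<ge> 0"
      using dominant_in_orbit[OF \<rho>v] by blast
    define \<kappa> where "\<kappa> = w (\<rho> + v)"
    have \<kappa>: "\<kappa> \<in> \<Lambda>" using weyl_lattice[OF w \<rho>v] by (simp add: \<kappa>_def)
    have "\<exists>f. ?good (alternant \<alpha> J \<kappa>) f"
    proof (cases "\<exists>j\<in>J. \<kappa> \<bullet> coroot (\<alpha> j) = 0")
      case True
      then have "alternant \<alpha> J \<kappa> = 0" using alternant_singular by blast
      then show ?thesis by (intro exI[of _ 0]) simp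
    next
      case False
      \<comment> \<open>The products of \<open>\<kappa>\<close> with simple coroots are positive
        integers, hence at least 1, which is the product of \<rho>.\<close>
      have "(\<kappa> - \<rho>) \<bullet> coroot (\<alpha> j) \<ge> 0" if j: "j \<in> J" for j
      proof -
        have "\<kappa> \<bullet> coroot (\<alpha> j) \<in> \<int>" using \<kappa> j by (simp add: weight_lattice_iff)
        then obtain m :: int where "\<kappa> \<bullet> coroot (\<alpha> j) = of_int m" by (auto elim: Ints_cases)
        moreover have "\<kappa> \<bullet> coroot (\<alpha> j) > 0" using wdom[OF j] False j by (force simp: \<kappa>_def less_le)
        ultimately show ?thesis by (simp add: inner_diff_left weyl_vector_coroot[OF j])
      qed
      then have dom\<kappa>: "\<kappa> - \<rho> \<in> dominant_weights \<alpha> J"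
        using weight_lattice_diff[OF \<kappa> weyl_vector_lattice] by (simp add: dominant_weights_iff)
      have lt: "norm \<kappa> < norm (\<mu> + \<rho>)" using shorter by (simp add: \<kappa>_def weyl_norm[OF w])
      have "finite {v \<in> \<Lambda>. norm v < norm (\<mu> + \<rho>)}"
        by (rule finite_subset[OF _ finite_weights_norm_le[of "norm (\<mu> + \<rho>)"]]) auto
      \<comment> \<open>The inclusion is strict because \<open>\<kappa>\<close> lies only in the
        larger set.\<close>
      then have "card {v \<in> \<Lambda>. norm v < norm \<kappa>} < card {v \<in> \<Lambda>. norm v < norm (\<mu> + \<rho>)}"
        using lt \<kappa> by (intro psubset_card_mono) auto
      then show ?thesis using less.hyps[OF _ dom\<kappa>] by simp
    qed
    moreover have "alternant \<alpha> J (\<rho> + v) = alternant \<alpha> J \<kappa> \<or> alternant \<alpha> J (\<rho> + v) = - alternant \<alpha> J \<kappa>"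
      using alternant_weyl[OF w, of "\<rho> + v"] by (auto simp: \<kappa>_def)
    ultimately show ?thesis by (elim disjE) (simp_all only: good_uminus)
  qed
  then obtain F where F: "\<And>v. v \<in> orb - {\<mu>} \<Longrightarrow> ?good (alternant \<alpha> J (\<rho> + v)) (F v)" by metis
  \<comment> \<open>From the orbit sum, the solutions for all orbit weights other than
    \<open>\<mu>\<close> are removed, leaving the alternant of
    \<open>\<rho> + \<mu>\<close>.\<close>
  define f where "f = (\<Sum>v\<in>orb. fexp v) - (\<Sum>v\<in>orb - {\<mu>}. F v)"
  have "Poly_Mapping.keys (\<Sum>v\<in>orb. fexp v) \<subseteq> \<Lambda>"
    using keys_sum[of fexp orb] orb_lattice by auto
  moreover have "Poly_Mapping.keys (\<Sum>v\<in>orb - {\<mu>}. F v) \<subseteq> \<Lambda>"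
    using keys_sum[of F "orb - {\<mu>}"] F by blast
  ultimately have "Poly_Mapping.keys f \<subseteq> \<Lambda>"
    unfolding f_def by (intro subset_trans[OF keys_diff] Un_least)
  moreover have "alternant \<alpha> J \<rho> * f = alternant \<alpha> J (\<mu> + \<rho>)"
  proof -
    have "(\<Sum>v\<in>orb - {\<mu>}. alternant \<alpha> J \<rho> * F v)
        = (\<Sum>v\<in>orb - {\<mu>}. alternant \<alpha> J (\<rho> + v))"
      using F by (intro sum.cong refl) blast
    then have "alternant \<alpha> J \<rho> * f
        = (\<Sum>v\<in>orb. alternant \<alpha> J (\<rho> + v)) - (\<Sum>v\<in>orb - {\<mu>}. alternant \<alpha> J (\<rho> + v))"
      by (simp only: f_def right_diff_distrib orbit_sum sum_distrib_left[of _ F])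
    also have "\<dots> = alternant \<alpha> J (\<rho> + \<mu>)"
      by (simp only: sum.remove[OF fin_orb \<mu>_orb] add_diff_cancel_right')
    finally show ?thesis by (simp only: add.commute[of \<mu>])
  qed
  ultimately show ?case by blast
qed

text \<open>Existence, together with uniqueness by cancelling the alternant of \<rho>, makes the
  definite description in \<open>bialternant\<close> meaningful.\<close>

lemma alternant_mult_bialternant:
  assumes "\<mu> \<in> dominant_weights \<alpha> J"
  shows "alternant \<alpha> J \<rho> * bialternant \<alpha> J \<mu> = alternant \<alpha> J (\<mu> + \<rho>)"
proof -
  let ?P = "\<lambda>f. Poly_Mapping.keys f \<subseteq> \<Lambda> \<and> alternant \<alpha> J \<rho> * f = alternant \<alpha> J (\<mu> + \<rho>)"
  obtain f where f: "?P f" using bialternant_exists[OF assms] by blast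
  have "g = f" if "?P g" for g
    using alternant_weyl_vector_cancel[of "g - f"] that f by (simp add: right_diff_distrib)
  then have "?P (THE f. ?P f)" using f by (rule theI[rotated])
  then show ?thesis by (simp add: bialternant_def)
qed

end

section \<open>The product formula\<close>

theorem theorem4p1:
  fixes \<Phi> :: "(real ^ 'n) set" and I J :: "'i set" and \<alpha> :: "'i \<Rightarrow> real ^ 'n"
    and R S :: "'v set" and r :: "'v rel" and col :: "'v \<times> 'v \<Rightarrow> 'i"
    and \<nu> :: "real ^ 'n" and \<nu>c :: "'i \<Rightarrow> int"
    and \<tau> :: "'v \<Rightarrow> 'v" and \<kappa> :: "'v \<Rightarrow> 'i"
  assumes "root_system \<Phi>" and "simple_roots \<Phi> I \<alpha>"
    and "ranked_poset R r" and "\<forall>e\<in>hasse r. col e \<in> I"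
    and "J \<subseteq> I"
    and "\<nu> \<in> dominant_weights \<alpha> J" and "\<nu> = (\<Sum>j\<in>J. of_int (\<nu>c j) *\<^sub>R fund_weight \<alpha> J j)"
    and "weyl_invariant \<alpha> J (push_weights (restrict_weight \<alpha> J) (WGF \<alpha> I R r col))"
    and "S \<subseteq> R" and "\<forall>s\<in>S. \<nu> + wt \<alpha> J r col s \<in> dominant_weights \<alpha> J"
    and "bij_betw \<tau> (R - S) (R - S)" and "\<kappa> ` (R - S) \<subseteq> J"
    and "\<forall>x\<in>R - S. wt \<alpha> J r col (\<tau> x) =
           wt \<alpha> J r col x - of_int (1 + \<nu>c (\<kappa> x) + mval r col (\<kappa> x) x) *\<^sub>R \<alpha> (\<kappa> x)"
  shows "bialternant \<alpha> J \<nu> * push_weights (restrict_weight \<alpha> J) (WGF \<alpha> I R r col) =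
    (\<Sum>s\<in>S. bialternant \<alpha> J (\<nu> + wt \<alpha> J r col s))"
proof -
  interpret based_root_system "root_subsystem \<Phi> \<alpha> J" J \<alpha>
    using root_subsystem_root_system[OF assms(1)] root_subsystem_simple_roots[OF assms(1,2,5)]
    by unfold_locales
  let ?p = "wt \<alpha> J r col"
  let ?A = "alternant \<alpha> J"
  let ?F = "push_weights (restrict_weight \<alpha> J) (WGF \<alpha> I R r col)"
  have finR: "finite R" using assms(3) by (simp add: ranked_poset_def)
  \<comment> \<open>Restriction to \<open>J\<close> turns the weights
    \<open>wt \<alpha> I r col x\<close> into \<open>wt \<alpha> J r col x\<close>.\<close>
  have F: "?F = (\<Sum>x\<in>R. fexp (?p x))"
    unfolding WGF_def push_weights_sum_fexp[OF finR]
    by (simp add: wt_def restrict_weight_sum[OF assms(1,2,5)])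
  have anti: "?A (\<nu> + \<rho> + ?p (\<tau> x)) = - ?A (\<nu> + \<rho> + ?p x)" if x: "x \<in> R - S" for x
  proof -
    have j: "\<kappa> x \<in> J" using assms(12) x by blast
    \<comment> \<open>The summand 1 comes from \<rho>, the other two from \<nu> and the weight of
      \<open>x\<close>; so the shift prescribed for \<open>\<tau>\<close> is exactly a simple
      reflection.\<close>
    have "(\<nu> + \<rho> + ?p x) \<bullet> coroot (\<alpha> (\<kappa> x)) = of_int (1 + \<nu>c (\<kappa> x) + mval r col (\<kappa> x) x)"
      unfolding inner_add_left weyl_vector_coroot[OF j] assms(7) wt_def fund_weight_comb(2)[OF j]
      by simp
    then have "s (\<kappa> x) (\<nu> + \<rho> + ?p x) = \<nu> + \<rho> + ?p (\<tau> x)"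
      using assms(13) x by (simp add: reflection_def)
    then show ?thesis using alternant_reflection[OF j, of "\<nu> + \<rho> + ?p x"] by simp
  qed
  \<comment> \<open>Only bijectivity of \<open>\<tau>\<close> enters: reindexing replaces pairing
    elements, so \<open>\<tau>\<close> may be any permutation, not just an involution.\<close>
  have "(\<Sum>x\<in>R - S. ?A (\<nu> + \<rho> + ?p x)) = (\<Sum>x\<in>R - S. ?A (\<nu> + \<rho> + ?p (\<tau> x)))"
    using sum.reindex_bij_betw[OF assms(11), of "\<lambda>x. ?A (\<nu> + \<rho> + ?p x)"] by simp
  also have "\<dots> = - (\<Sum>x\<in>R - S. ?A (\<nu> + \<rho> + ?p x))"
    by (simp add: anti sum_negf)
  finally have rest: "(\<Sum>x\<in>R - S. ?A (\<nu> + \<rho> + ?p x)) = 0" by (rule poly_mapping_eq_neg)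
  have "?A \<rho> * (bialternant \<alpha> J \<nu> * ?F) = ?A (\<nu> + \<rho>) * (\<Sum>x\<in>R. fexp (?p x))"
    by (simp add: F alternant_mult_bialternant[OF assms(6)] flip: mult.assoc)
  also have "\<dots> = (\<Sum>x\<in>R. ?A (\<nu> + \<rho> + ?p x))"
    using assms(8) F by (intro alternant_mult_invariant[OF finR]) simp
  also have "\<dots> = (\<Sum>x\<in>S. ?A (\<nu> + \<rho> + ?p x))"
    using sum.subset_diff[OF assms(9) finR, of "\<lambda>x. ?A (\<nu> + \<rho> + ?p x)"] rest by simp
  also have "\<dots> = (\<Sum>x\<in>S. ?A \<rho> * bialternant \<alpha> J (\<nu> + ?p x))"
    using assms(10) by (intro sum.cong) (simp_all add: alternant_mult_bialternant algebra_simps)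
  also have "\<dots> = ?A \<rho> * (\<Sum>x\<in>S. bialternant \<alpha> J (\<nu> + ?p x))"
    by (simp add: sum_distrib_left)
  finally have "?A \<rho> * (bialternant \<alpha> J \<nu> * ?F - (\<Sum>x\<in>S. bialternant \<alpha> J (\<nu> + ?p x))) = 0"
    by (simp add: right_diff_distrib)
  then show ?thesis using alternant_weyl_vector_cancel by fastforce
qed

end
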